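(* Let $X$ be a complex Banach space and let $\varepsilon>0$. Let $(x_n)$ be a bounded sequence in $X$ which admits $\varepsilon$-$\ell^1$-blocks. Then there is a subsequence $(x_{n_k})$ of $(x_n)$ such that for every $x'\in X'$ with $\|x'\|=1$ the diameter of the set of cluster points (in $\mathbb{C}$) of the sequence $(x'(x_{n_k}))_k$ is at most $\pi\varepsilon$.
   Context: $X'$ denotes the dual of the Banach space $X$. Definition: a bounded sequence $(x_n)$ in a Banach space $X$ admits $\varepsilon$-$\ell^1$-blocks (where $\varepsilon>0$) if for every infinite $M\subset\mathbb{N}$ there are $r\in\mathbb{N}$, scalars $a_1,\dots,a_r$ with $\sum_{\rho=1}^r|a_\rho|=1$ and indices $i_1<\dots<i_r$ in $M$ such that $\left\|\sum_{\rho=1}^r a_\rho x_{i_\rho}\right\|\leq\varepsilon$. *)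

theory Defs
  imports "HOL-Analysis.Analysis"
begin

text \<open>The real scalar multiplication of a complex normed space is the restriction of the
  complex one, so the library's \<open>norm\<close>, \<open>bounded_linear\<close> and \<open>onorm\<close> apply to it.\<close>

class scaleC =
  fixes scaleC :: "complex \<Rightarrow> 'a \<Rightarrow> 'a"  (infixr \<open>*\<^sub>C\<close> 75)

class complex_normed_vector = real_normed_vector + scaleC +
  assumes scaleC_add_right: "c *\<^sub>C (x + y) = c *\<^sub>C x + c *\<^sub>C y"
    and scaleC_add_left: "(c + d) *\<^sub>C x = c *\<^sub>C x + d *\<^sub>C x"
    and scaleC_scaleC: "c *\<^sub>C (d *\<^sub>C x) = (c * d) *\<^sub>C x"
    and scaleC_complex_of_real: "complex_of_real r *\<^sub>C x = r *\<^sub>R x"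
    and norm_scaleC: "norm (c *\<^sub>C x) = cmod c * norm x"

class complex_banach = complex_normed_vector + complete_space

instantiation complex :: complex_banach
begin

definition scaleC_complex :: "complex \<Rightarrow> complex \<Rightarrow> complex" where
  "scaleC_complex c z = c * z"

instance
  by standard (simp_all add: scaleC_complex_def algebra_simps scaleR_conv_of_real norm_mult)

end

definition complex_dual :: "('a::complex_normed_vector \<Rightarrow> complex) set" where
  "complex_dual = {f. bounded_linear f \<and> (\<forall>c x. f (c *\<^sub>C x) = c * f x)}"

text \<open>The sum condition forces \<open>r \<ge> 1\<close>.\<close>

definition admits_l1_blocks :: "real \<Rightarrow> (nat \<Rightarrow> 'a::complex_normed_vector) \<Rightarrow> bool" where
  "admits_l1_blocks \<epsilon> x \<longleftrightarrow>
     (\<forall>M::nat set. infinite M \<longrightarrow>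
        (\<exists>(r::nat) (a::nat \<Rightarrow> complex) (i::nat \<Rightarrow> nat).
           (\<Sum>\<rho>=1..r. cmod (a \<rho>)) = 1 \<and>
           strict_mono_on {1..r} i \<and> i ` {1..r} \<subseteq> M \<and>
           norm (\<Sum>\<rho>=1..r. a \<rho> *\<^sub>C x (i \<rho>)) \<le> \<epsilon>))"

definition cluster_points :: "(nat \<Rightarrow> 'a::topological_space) \<Rightarrow> 'a set" where
  "cluster_points s =
     {z. \<forall>U. open U \<longrightarrow> z \<in> U \<longrightarrow> (\<exists>\<^sub>F k in sequentially. s k \<in> U)}"

end

theory Submission
  imports Defs
begin

text \<open>
  Suppose that every subsequence has a norm-one functional whose values along it cluster at two
  points more than \<open>\<pi>\<epsilon>\<close> apart. The two cluster points vary with the subsequence, but there are only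
  countably many pairs of basic open sets in which they can be caught. A diagonal argument
  (\<open>countable_alternatives_stabilise\<close>) therefore yields one pair \<open>U\<close>, \<open>V\<close> of small open sets, far from
  each other, and an infinite index set \<open>N\<close> such that for every infinite \<open>M \<subseteq> N\<close> some norm-one
  functional \<open>f\<close> has \<open>f (x m) \<in> U\<close> for infinitely many \<open>m \<in> M\<close> and \<open>f (x m) \<in> V\<close> for infinitely
  many \<open>m \<in> M\<close>.

  This is the situation of the combinatorial core of Rosenthal's \<open>\<ell>\<^sup>1\<close>-theorem: inside \<open>N\<close> there is an
  infinite \<open>K\<close> on which the two conditions are independent, so that on any finite subset of \<open>K\<close> every
  prescribed choice between \<open>U\<close> and \<open>V\<close> is realised by some norm-one functional
  (\<open>independent_subset\<close>).

  Now take a block \<open>v = \<Sum> a\<^sub>i x\<^sub>i\<close> over \<open>K\<close> with \<open>\<Sum> \<bar>a\<^sub>i\<bar> = 1\<close> and norm at most \<open>\<epsilon>\<close>. Averaging over all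
  directions of the plane produces signs \<open>\<sigma>\<^sub>i\<close> with \<open>\<bar>\<Sum> \<sigma>\<^sub>i a\<^sub>i\<bar> \<ge> 2/\<pi>\<close>, because \<open>2/\<pi>\<close> is the mean of
  \<open>\<bar>cos\<bar>\<close> (\<open>exists_signs_two_over_pi\<close>). Let \<open>f\<close> and \<open>g\<close> follow these signs and the opposite ones.
  If \<open>U\<close> and \<open>V\<close> are concentrated near \<open>z\<close> and \<open>w\<close>, then \<open>f v - g v\<close> is nearly
  \<open>(\<Sum> \<sigma>\<^sub>i a\<^sub>i) (z - w)\<close>, whereas its modulus is at most \<open>2\<epsilon>\<close>. Hence \<open>2/\<pi> \<bar>z - w\<bar>\<close> is at most \<open>2\<epsilon>\<close> up to
  a small error, which contradicts the distance between \<open>z\<close> and \<open>w\<close>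
  (\<open>block_forces_close_discs\<close>).
\<close>

section \<open>Signs for complex coefficients\<close>

text \<open>The integrand \<open>\<bar>h\<bar>\<close> is the length of the projection of \<open>a\<close> to the direction \<open>t\<close>, that is, the modulus
  of \<open>Re (a cis(-t))\<close>. Instead of passing to polar coordinates, the proof splits \<open>[0, \<pi>]\<close> at a zero \<open>c\<close>
  of \<open>h\<close> and applies the triangle inequality to the two integrals of \<open>h\<close> itself: the antiderivative \<open>H\<close>
  has modulus \<open>\<bar>a\<bar>\<close> at \<open>c\<close> and takes opposite values at the two end points.\<close>

lemma integral_abs_cos_projection:
  fixes a :: complex
  shows "2 * cmod a \<le> integral {0..pi} (\<lambda>t. \<bar>Re a * cos t + Im a * sin t\<bar>)"
proof -
  define h where "h t = Re a * cos t + Im a * sin t" for t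
  define H where "H t = Re a * sin t - Im a * cos t" for t
  have cont: "continuous_on S h" for S
    unfolding h_def by (intro continuous_intros)
  have HI: "(h has_integral H v - H u) {u..v}" if "u \<le> v" for u v
    unfolding h_def H_def
    by (rule fundamental_theorem_of_calculus[OF that])
       (auto intro!: derivative_eq_intros simp flip: has_real_derivative_iff_has_vector_derivative)
  have int_abs: "(\<lambda>t. \<bar>h t\<bar>) integrable_on {u..v}" for u v
    by (intro integrable_continuous_real continuous_intros cont)
  have step: "\<bar>H v - H u\<bar> \<le> integral {u..v} (\<lambda>t. \<bar>h t\<bar>)" if "u \<le> v" for u v
    using integral_norm_bound_integral[of h "{u..v}" "\<lambda>t. \<bar>h t\<bar>"] int_abs HI[OF that]
    by (auto simp: integral_unique intro: has_integral_integrable)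
  \<comment> \<open>\<open>h\<close> takes opposite values at \<open>0\<close> and \<open>\<pi>\<close>.\<close>
  have "\<exists>c\<in>{0..pi}. h c = 0"
  proof (cases "h 0 \<le> 0")
    case True
    then show ?thesis
      using IVT'[of h 0 0 pi] cont by (auto simp: h_def)
  next
    case False
    then show ?thesis
      using IVT2'[of h pi 0 0] cont by (auto simp: h_def)
  qed
  then obtain c where c: "0 \<le> c" "c \<le> pi" "h c = 0" by auto
  have "(h c)\<^sup>2 + (H c)\<^sup>2 = ((Re a)\<^sup>2 + (Im a)\<^sup>2) * ((sin c)\<^sup>2 + (cos c)\<^sup>2)"
    unfolding h_def H_def by algebra
  then have "(H c)\<^sup>2 = (cmod a)\<^sup>2"
    using c by (simp add: cmod_power2)
  then have "\<bar>H c\<bar> = cmod a"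
    by (metis abs_norm_cancel power2_eq_iff_nonneg abs_ge_zero power2_abs)
  moreover have "H 0 = - H pi" by (simp add: H_def)
  ultimately have "2 * cmod a \<le> \<bar>H c - H 0\<bar> + \<bar>H pi - H c\<bar>"
    by linarith
  also have "\<dots> \<le> integral {0..c} (\<lambda>t. \<bar>h t\<bar>) + integral {c..pi} (\<lambda>t. \<bar>h t\<bar>)"
    using step[of 0 c] step[of c pi] c by linarith
  also have "\<dots> = integral {0..pi} (\<lambda>t. \<bar>h t\<bar>)"
    using c int_abs by (intro Henstock_Kurzweil_Integration.integral_combine) auto
  finally show ?thesis by (simp add: h_def)
qed

text \<open>By the previous lemma the sum \<open>g t\<close> of the projection lengths of all \<open>a i\<close> to the direction \<open>t\<close> has
  mean at least \<open>2/\<pi> \<Sum> \<bar>a i\<bar>\<close> over \<open>[0, \<pi>]\<close>, so some direction does as well as the mean. Giving each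
  coefficient the sign of its component in that direction makes all components add up.\<close>

lemma exists_signs_two_over_pi:
  fixes a :: "'i \<Rightarrow> complex"
  assumes "finite F"
  shows "\<exists>P. 2 / pi * (\<Sum>i\<in>F. cmod (a i)) \<le> cmod (\<Sum>i\<in>F. (if i \<in> P then a i else - a i))"
proof -
  define h where "h i t = Re (a i) * cos t + Im (a i) * sin t" for i t
  define g where "g t = (\<Sum>i\<in>F. \<bar>h i t\<bar>)" for t
  have cont_h: "continuous_on S (\<lambda>t. \<bar>h i t\<bar>)" for S i
    unfolding h_def by (intro continuous_intros)
  have cont: "continuous_on S g" for S
    unfolding g_def by (intro continuous_intros cont_h)
  obtain t where t: "\<And>s. s \<in> {0..pi} \<Longrightarrow> g s \<le> g t"
    using continuous_attains_sup[of "{0..pi}" g] cont by (metis atLeastAtMost_iff compact_Icc empty_iff order_refl pi_ge_zero)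
  have "2 * (\<Sum>i\<in>F. cmod (a i)) \<le> (\<Sum>i\<in>F. integral {0..pi} (\<lambda>s. \<bar>h i s\<bar>))"
    unfolding h_def sum_distrib_left by (intro sum_mono integral_abs_cos_projection)
  also have "\<dots> = integral {0..pi} g"
    unfolding g_def
    by (rule integral_sum[symmetric]) (auto intro: assms integrable_continuous_real cont_h)
  also have "\<dots> \<le> integral {0..pi} (\<lambda>_. g t)"
    by (intro integral_le integrable_continuous_real cont t) auto
  also have "\<dots> = pi * g t" by simp
  finally have *: "2 / pi * (\<Sum>i\<in>F. cmod (a i)) \<le> g t"
    by (simp add: field_simps)
  define P where "P = {i. 0 \<le> h i t}"
  let ?S = "\<Sum>i\<in>F. (if i \<in> P then a i else - a i)"
  have "g t = (\<Sum>i\<in>F. Re (cis (- t) * (if i \<in> P then a i else - a i)))"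
    unfolding g_def by (intro sum.cong) (auto simp: P_def h_def algebra_simps)
  also have "\<dots> = Re (cis (- t) * ?S)"
    by (simp only: sum_distrib_left Re_sum)
  also have "\<dots> \<le> cmod (cis (- t) * ?S)" by (rule complex_Re_le_cmod)
  also have "\<dots> = cmod ?S" by (simp add: norm_mult)
  finally show ?thesis using * by (meson order_trans)
qed

section \<open>Fusion\<close>

text \<open>The bookkeeping common to all the diagonal arguments below. A stage consists of a finite set \<open>F\<close> of
  elements already chosen and an infinite reservoir \<open>N\<close>; one step moves an element from the reservoir
  to \<open>F\<close> and thins out the rest. The set \<open>M\<close> of all elements ever chosen lies in each reservoir up
  to finitely many elements, so facts about a reservoir that ignore finite sets pass to \<open>M\<close>.\<close>

lemma fusion:
  fixes N :: "'b set"
  assumes N: "infinite N" "I {} N"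
    and step: "\<And>F N. finite F \<Longrightarrow> infinite N \<Longrightarrow> I F N \<Longrightarrow>
                 \<exists>m\<in>N. \<exists>N'\<subseteq>N - {m}. infinite N' \<and> I (insert m F) N'"
  shows "\<exists>M\<subseteq>N. infinite M \<and>
           (\<forall>F\<subseteq>M. finite F \<longrightarrow> (\<exists>F' N'. finite F' \<and> F \<subseteq> F' \<and> I F' N' \<and> finite (M - N')))"
proof -
  define Q where "Q s s' \<longleftrightarrow> (\<exists>m\<in>snd s. fst s' = insert m (fst s) \<and> snd s' \<subseteq> snd s - {m})"
    for s s' :: "'b set \<times> 'b set"
  have "\<exists>s. \<forall>n. ((finite (fst (s n)) \<and> infinite (snd (s n)) \<and> I (fst (s n)) (snd (s n)))
                  \<and> (n = 0 \<longrightarrow> s n = ({}, N))) \<and> Q (s n) (s (Suc n))"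
  proof (rule dependent_nat_choice)
    show "\<exists>s. (finite (fst s) \<and> infinite (snd s) \<and> I (fst s) (snd s)) \<and> (0 = (0::nat) \<longrightarrow> s = ({}, N))"
      using N by auto
  next
    fix s :: "'b set \<times> 'b set" and n :: nat
    assume s: "(finite (fst s) \<and> infinite (snd s) \<and> I (fst s) (snd s)) \<and> (n = 0 \<longrightarrow> s = ({}, N))"
    then obtain m N' where "m \<in> snd s" "N' \<subseteq> snd s - {m}" "infinite N'" "I (insert m (fst s)) N'"
      using step[of "fst s" "snd s"] by blast
    then show "\<exists>s'. ((finite (fst s') \<and> infinite (snd s') \<and> I (fst s') (snd s'))
                 \<and> (Suc n = 0 \<longrightarrow> s' = ({}, N))) \<and> Q s s'"
      using s by (intro exI[of _ "(insert m (fst s), N')"]) (auto simp: Q_def)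
  qed
  then obtain s where s: "\<And>n. finite (fst (s n))" "\<And>n. I (fst (s n)) (snd (s n))"
      "s 0 = ({}, N)" "\<And>n. Q (s n) (s (Suc n))"
    by blast
  from s(4) obtain m where m: "\<And>n. m n \<in> snd (s n)" "\<And>n. fst (s (Suc n)) = insert (m n) (fst (s n))"
      "\<And>n. snd (s (Suc n)) \<subseteq> snd (s n) - {m n}"
    unfolding Q_def by metis
  have anti: "snd (s l) \<subseteq> snd (s k)" if "k \<le> l" for k l
    using m(3) by (intro lift_Suc_antimono_le[of "\<lambda>n. snd (s n)", OF _ that]) blast
  have F: "fst (s n) = m ` {..<n}" for n
    by (induction n) (auto simp: s(3) m(2) lessThan_Suc)
  have "m l \<noteq> m k" if "k < l" for k l
    using m(1)[of l] anti[of "Suc k" l] m(3)[of k] that by auto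
  then have "inj m"
    by (metis injI linorder_neqE_nat)
  have tail: "range m - snd (s n) \<subseteq> m ` {..<n}" for n
  proof clarify
    fix k assume "m k \<notin> snd (s n)"
    then show "m k \<in> m ` {..<n}" using m(1)[of k] anti[of n k] by (cases "k < n") auto
  qed
  have "\<exists>F' N'. finite F' \<and> F \<subseteq> F' \<and> I F' N' \<and> finite (range m - N')"
    if FM: "F \<subseteq> range m" "finite F" for F
  proof -
    obtain C where C: "finite C" "F = m ` C"
      using finite_subset_image[OF FM(2,1)] by blast
    then obtain n where "C \<subseteq> {..<n}"
      using finite_nat_iff_bounded by blast
    then have "F \<subseteq> fst (s n)" using C F by auto
    then show ?thesis
      using s tail[of n] by (meson finite_imageI finite_lessThan finite_subset)
  qed
  moreover have "range m \<subseteq> N" using m(1) anti[of 0] s(3) by auto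
  moreover have "infinite (range m)" using \<open>inj m\<close> by (rule range_inj_infinite)
  ultimately show ?thesis by blast
qed

text \<open>If no alternative \<open>k\<close> worked for all infinite subsets of some infinite set, then alternatives
  \<open>0, 1, 2, \<dots>\<close> could be destroyed one after the other by thinning out, and the fused set would admit
  none at all. The cardinality of the set of chosen elements counts the alternatives already
  destroyed.\<close>

lemma countable_alternatives_stabilise:
  fixes Q :: "nat \<Rightarrow> 'b set \<Rightarrow> bool"
  assumes N: "infinite N"
    and some: "\<And>M. M \<subseteq> N \<Longrightarrow> infinite M \<Longrightarrow> \<exists>k. Q k M"
    and almost_mono: "\<And>k M M'. Q k M \<Longrightarrow> finite (M - M') \<Longrightarrow> Q k M'"
  shows "\<exists>k. \<exists>N'\<subseteq>N. infinite N' \<and> (\<forall>M\<subseteq>N'. infinite M \<longrightarrow> Q k M)"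
proof (rule ccontr)
  assume contra: "\<not> ?thesis"
  define I where "I F M \<longleftrightarrow> M \<subseteq> N \<and> (\<forall>k < card F. \<not> Q k M)" for F M :: "'b set"
  have step: "\<exists>m\<in>M. \<exists>M'\<subseteq>M - {m}. infinite M' \<and> I (insert m F) M'"
    if "finite F" "infinite M" "I F M" for F M
  proof -
    obtain m where m: "m \<in> M" using \<open>infinite M\<close> by (metis finite.emptyI equals0I)
    have M: "M \<subseteq> N" "\<And>k. k < card F \<Longrightarrow> \<not> Q k M" using \<open>I F M\<close> by (auto simp: I_def)
    have M0: "infinite (M - {m})" "M - {m} \<subseteq> N" using \<open>infinite M\<close> M by auto
    have "\<not> (\<forall>M'\<subseteq>M - {m}. infinite M' \<longrightarrow> Q (card F) M')"
      using contra[unfolded not_ex, THEN spec, of "card F", THEN spec, of "M - {m}"] M0 by simp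
    then obtain M' where M': "M' \<subseteq> M - {m}" "infinite M'" and new: "\<not> Q (card F) M'" by blast
    have "\<not> Q k M'" if "k < card (insert m F)" for k
    proof (cases "k = card F")
      case True
      then show ?thesis using new by simp
    next
      case False
      then have "k < card F"
        using that card_insert_if[OF \<open>finite F\<close>, of m] by (simp split: if_splits)
      moreover have "finite (M' - M)" using M'(1) by (simp add: Diff_eq_empty_iff[THEN iffD2] subset_Diff_insert)
      ultimately show ?thesis using M(2) almost_mono by blast
    qed
    then have "I (insert m F) M'" using M' M(1) by (auto simp: I_def)
    then show ?thesis using m M' by blast
  qed
  have "I {} N" by (simp add: I_def)
  from fusion[of N I, OF N this step] obtain K where K: "K \<subseteq> N" "infinite K"
    and fus: "\<And>F. F \<subseteq> K \<Longrightarrow> finite F \<Longrightarrow> \<exists>F' N'. finite F' \<and> F \<subseteq> F' \<and> I F' N' \<and> finite (K - N')"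
    by blast
  obtain k where k: "Q k K" using some K by blast
  obtain F where F: "F \<subseteq> K" "finite F" "card F = Suc k"
    using infinite_arbitrarily_large[OF K(2)] by metis
  obtain F' N' where "finite F'" "F \<subseteq> F'" "I F' N'" "finite (K - N')" using fus F by metis
  then have "k < card F'" using F card_mono[of F' F] by simp
  then have "\<not> Q k N'" using \<open>I F' N'\<close> by (auto simp: I_def)
  then show False using almost_mono k \<open>finite (K - N')\<close> by blast
qed

section \<open>Independence\<close>

definition separates :: "('b \<Rightarrow> 'w set) \<Rightarrow> ('b \<Rightarrow> 'w set) \<Rightarrow> 'w \<Rightarrow> 'b set \<Rightarrow> bool" where
  "separates A B \<omega> M \<longleftrightarrow> infinite {m\<in>M. \<omega> \<in> A m} \<and> infinite {m\<in>M. \<omega> \<in> B m}"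

definition follows :: "('b \<Rightarrow> 'w set) \<Rightarrow> ('b \<Rightarrow> 'w set) \<Rightarrow> 'w \<Rightarrow> 'b set \<Rightarrow> 'b set \<Rightarrow> bool" where
  "follows A B \<omega> P F \<longleftrightarrow> (\<forall>m\<in>F. \<omega> \<in> (if m \<in> P then A m else B m))"

lemma separates_almost_mono:
  assumes "separates A B \<omega> M" "finite (M - M')"
  shows "separates A B \<omega> M'"
proof -
  have "infinite {m\<in>M'. \<omega> \<in> C m}" if "infinite {m\<in>M. \<omega> \<in> C m}" for C
  proof
    assume "finite {m\<in>M'. \<omega> \<in> C m}"
    then have "finite ({m\<in>M'. \<omega> \<in> C m} \<union> (M - M'))" using assms by blast
    moreover have "{m\<in>M. \<omega> \<in> C m} \<subseteq> {m\<in>M'. \<omega> \<in> C m} \<union> (M - M')" by auto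
    ultimately show False using that finite_subset by blast
  qed
  then show ?thesis using assms(1) by (simp add: separates_def)
qed

text \<open>The inductive step of the construction of an independent set. Patterns on \<open>F\<close> are encoded as
  sets \<open>P\<close>, up to their intersection with \<open>F\<close>. If no \<open>m\<close> could be added, then each candidate \<open>m\<close> would
  have a pattern \<open>P m\<close> on \<open>insert m F\<close> and an infinite set on which no point following \<open>P m\<close>
  separates; by fusion these infinite sets can be replaced by a single \<open>K\<close>. There are only
  finitely many patterns on \<open>F\<close>, so infinitely many candidates \<open>m \<in> L\<close> share the restriction of
  \<open>P m\<close> to \<open>F\<close> and the choice at the new element \<open>m\<close>. But some point follows that restriction
  and separates \<open>L\<close>, hence makes the required choice at infinitely many \<open>m \<in> L\<close>; for such an \<open>m\<close>
  it follows \<open>P m\<close>, a contradiction.\<close>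

lemma pattern_extension:
  fixes A B :: "'b \<Rightarrow> 'w set"
  assumes F: "finite F" and N: "infinite N"
    and good: "\<And>P M. M \<subseteq> N \<Longrightarrow> infinite M \<Longrightarrow> \<exists>\<omega>. follows A B \<omega> P F \<and> separates A B \<omega> M"
  shows "\<exists>m\<in>N. \<exists>N'\<subseteq>N - {m}. infinite N' \<and>
           (\<forall>P M. M \<subseteq> N' \<longrightarrow> infinite M \<longrightarrow> (\<exists>\<omega>. follows A B \<omega> P (insert m F) \<and> separates A B \<omega> M))"
proof (rule ccontr)
  assume contra: "\<not> ?thesis"
  define bad where "bad m P M \<longleftrightarrow> \<not> (\<exists>\<omega>. follows A B \<omega> P (insert m F) \<and> separates A B \<omega> M)" for m P M
  have bad_anti: "bad m P M'" if "bad m P M" "finite (M' - M)" for m P M M'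
    using that separates_almost_mono[of A B _ M' M] unfolding bad_def by blast
  define I where "I G M \<longleftrightarrow> M \<subseteq> N \<and> (\<forall>m\<in>G. \<exists>P. bad m P M)" for G M :: "'b set"
  have step: "\<exists>m\<in>M. \<exists>M'\<subseteq>M - {m}. infinite M' \<and> I (insert m G) M'"
    if "finite G" "infinite M" "I G M" for G M
  proof -
    obtain m where m: "m \<in> M" using \<open>infinite M\<close> by (metis finite.emptyI equals0I)
    have M: "M \<subseteq> N" using \<open>I G M\<close> by (simp add: I_def)
    have "infinite (M - {m})" "M - {m} \<subseteq> N - {m}" "m \<in> N" using \<open>infinite M\<close> M m by auto
    then have "\<not> (\<forall>P M'. M' \<subseteq> M - {m} \<longrightarrow> infinite M' \<longrightarrow> \<not> bad m P M')"
      using contra unfolding bad_def not_not by blast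
    then obtain P M' where M': "M' \<subseteq> M - {m}" "infinite M'" "bad m P M'" by blast
    have "finite (M' - M)" using M'(1) by (simp add: Diff_eq_empty_iff[THEN iffD2] subset_Diff_insert)
    then have "\<exists>P. bad m' P M'" if "m' \<in> G" for m'
      using \<open>I G M\<close> that bad_anti[of m' _ M M'] unfolding I_def by blast
    then have "I (insert m G) M'"
      using M' M unfolding I_def by blast
    then show ?thesis using m M' by blast
  qed
  have "I {} N" by (simp add: I_def)
  from fusion[of N I, OF N this step] obtain K where K: "K \<subseteq> N" "infinite K"
    and fus: "\<And>G. G \<subseteq> K \<Longrightarrow> finite G \<Longrightarrow> \<exists>F' N'. finite F' \<and> G \<subseteq> F' \<and> I F' N' \<and> finite (K - N')"
    by blast
  have "\<exists>P. bad m P K" if mK: "m \<in> K" for m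
  proof -
    obtain F' N' where "{m} \<subseteq> F'" "I F' N'" "finite (K - N')"
      using fus[of "{m}"] mK by blast
    then show ?thesis using bad_anti[of m _ N' K] unfolding I_def by blast
  qed
  then obtain P where P: "\<And>m. m \<in> K \<Longrightarrow> bad m (P m) K" by metis
  \<comment> \<open>Elements of \<open>F\<close> are discarded, since for them the choice at \<open>m\<close> is already part of the pattern on \<open>F\<close>.\<close>
  have "infinite (K - F)" using K F by simp
  moreover have "finite ((\<lambda>m. (P m \<inter> F, m \<in> P m)) ` (K - F))"
    by (rule finite_subset[of _ "Pow F \<times> UNIV"]) (use F in auto)
  ultimately obtain m0 where m0: "infinite {m\<in>K - F. (P m \<inter> F, m \<in> P m) = (P m0 \<inter> F, m0 \<in> P m0)}"
    using pigeonhole_infinite[of "K - F" "\<lambda>m. (P m \<inter> F, m \<in> P m)"] by blast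
  define L where "L = {m\<in>K - F. (P m \<inter> F, m \<in> P m) = (P m0 \<inter> F, m0 \<in> P m0)}"
  have L: "infinite L" "L \<subseteq> K" using m0 by (auto simp: L_def)
  then obtain \<omega> where \<omega>: "follows A B \<omega> (P m0) F" "separates A B \<omega> L"
    using good[of L "P m0"] K by blast
  have "infinite {m\<in>L. \<omega> \<in> (if m0 \<in> P m0 then A m else B m)}"
    using \<omega>(2) by (cases "m0 \<in> P m0") (auto simp: separates_def)
  then obtain m where m: "m \<in> L" "\<omega> \<in> (if m0 \<in> P m0 then A m else B m)"
    by (metis (no_types, lifting) Collect_empty_eq finite.emptyI)
  have "m' \<in> P m \<longleftrightarrow> m' \<in> P m0" if "m' \<in> F" for m'
    using m(1) that by (auto simp: L_def)
  then have "follows A B \<omega> (P m) (insert m F)"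
    using \<omega>(1) m by (auto simp: follows_def L_def)
  moreover have "separates A B \<omega> K"
    using separates_almost_mono[OF \<omega>(2), of K] L by (simp add: Diff_eq_empty_iff[THEN iffD2])
  moreover have "m \<in> K" using m L by blast
  ultimately show False using P unfolding bad_def by blast
qed

text \<open>The dichotomy behind Rosenthal's \<open>\<ell>\<^sup>1\<close>-theorem. The invariant demands more than independence of the
  elements chosen so far: every pattern on them must be realised by points that still separate any
  given infinite subset of the reservoir. This is what allows the construction to continue.\<close>

lemma independent_subset:
  fixes A B :: "'b \<Rightarrow> 'w set"
  assumes N: "infinite N"
    and sep: "\<And>M. M \<subseteq> N \<Longrightarrow> infinite M \<Longrightarrow> \<exists>\<omega>. separates A B \<omega> M"
  shows "\<exists>K\<subseteq>N. infinite K \<and> (\<forall>F\<subseteq>K. finite F \<longrightarrow> (\<forall>P. \<exists>\<omega>. follows A B \<omega> P F))"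
proof -
  define I where "I F N' \<longleftrightarrow> infinite N' \<and>
    (\<forall>P M. M \<subseteq> N' \<longrightarrow> infinite M \<longrightarrow> (\<exists>\<omega>. follows A B \<omega> P F \<and> separates A B \<omega> M))" for F N'
  have "I {} N" using N sep by (auto simp: I_def follows_def)
  have step: "\<exists>m\<in>M. \<exists>N'\<subseteq>M - {m}. infinite N' \<and> I (insert m F) N'"
    if "finite F" "infinite M" "I F M" for F M
    using pattern_extension[of F M A B] that unfolding I_def by blast
  from fusion[of N I, OF N \<open>I {} N\<close> step] obtain K where K: "K \<subseteq> N" "infinite K"
    and fus: "\<And>F. F \<subseteq> K \<Longrightarrow> finite F \<Longrightarrow> \<exists>F' N'. finite F' \<and> F \<subseteq> F' \<and> I F' N' \<and> finite (K - N')"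
    by blast
  have "\<exists>\<omega>. follows A B \<omega> P F" if FK: "F \<subseteq> K" "finite F" for P F
  proof -
    obtain F' N' where "F \<subseteq> F'" "I F' N'" using fus[OF FK] by blast
    then obtain \<omega> where "follows A B \<omega> P F'" unfolding I_def by blast
    then show ?thesis using \<open>F \<subseteq> F'\<close> unfolding follows_def by blast
  qed
  then show ?thesis using K by blast
qed

section \<open>Blocks\<close>

text \<open>Blocks indexed by a finite subset of \<open>M\<close> instead of an increasing enumeration of it, so that they
  match the finite sets on which patterns are prescribed.\<close>

lemma admits_l1_blocksE:
  assumes "admits_l1_blocks \<epsilon> x" "infinite M"
  obtains F a where "finite F" "F \<subseteq> M" "(\<Sum>i\<in>F. cmod (a i)) = 1" "norm (\<Sum>i\<in>F. a i *\<^sub>C x i) \<le> \<epsilon>"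
proof -
  obtain r :: nat and a i where *: "(\<Sum>\<rho>=1..r. cmod (a \<rho>)) = 1" "strict_mono_on {1..r} i" "i ` {1..r} \<subseteq> M"
      "norm (\<Sum>\<rho>=1..r. a \<rho> *\<^sub>C x (i \<rho>)) \<le> \<epsilon>"
    using assms(1)[unfolded admits_l1_blocks_def, rule_format, OF assms(2)] by blast
  have inj: "inj_on i {1..r}" using *(2) by (rule strict_mono_on_imp_inj_on)
  define b where "b = a \<circ> the_inv_into {1..r} i"
  have b: "b (i \<rho>) = a \<rho>" if "\<rho> \<in> {1..r}" for \<rho>
    using the_inv_into_f_f[OF inj that] by (simp add: b_def)
  show ?thesis
  proof
    show "finite (i ` {1..r})" "i ` {1..r} \<subseteq> M" using * by auto
    show "(\<Sum>j\<in>i ` {1..r}. cmod (b j)) = 1"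
      using *(1) by (simp add: sum.reindex[OF inj] b del: One_nat_def)
    show "norm (\<Sum>j\<in>i ` {1..r}. b j *\<^sub>C x j) \<le> \<epsilon>"
      using *(4) by (simp add: sum.reindex[OF inj] b del: One_nat_def)
  qed
qed

lemma complex_dual_sum:
  assumes "f \<in> complex_dual"
  shows "f (\<Sum>i\<in>F. a i *\<^sub>C x i) = (\<Sum>i\<in>F. a i * f (x i))"
proof -
  interpret f: bounded_linear f using assms by (simp add: complex_dual_def)
  show ?thesis using assms by (simp add: f.sum complex_dual_def)
qed

text \<open>Two functionals that follow opposite patterns on \<open>F\<close> differ at \<open>x i\<close> by \<open>\<plusminus>(z - w)\<close> up to \<open>2\<eta>\<close>. On
  the block \<open>v\<close> their difference is at most \<open>2\<epsilon>\<close> because each functional has norm one; with the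
  signs chosen above it is at least \<open>2/\<pi> \<bar>z - w\<bar> - 2\<eta>\<close>.\<close>

lemma block_forces_close_discs:
  fixes x :: "'i \<Rightarrow> 'a::complex_normed_vector"
  assumes F: "finite F" "(\<Sum>i\<in>F. cmod (a i)) = 1" "norm (\<Sum>i\<in>F. a i *\<^sub>C x i) \<le> \<epsilon>"
    and patterns: "\<And>P. \<exists>f\<in>complex_dual. onorm f = 1 \<and>
                       (\<forall>i\<in>F. f (x i) \<in> (if i \<in> P then ball z \<eta> else ball w \<eta>))"
  shows "cmod (z - w) \<le> pi * (\<epsilon> + \<eta>)"
proof -
  define v where "v = (\<Sum>i\<in>F. a i *\<^sub>C x i)"
  obtain P where P: "2 / pi * (\<Sum>i\<in>F. cmod (a i)) \<le> cmod (\<Sum>i\<in>F. (if i \<in> P then a i else - a i))"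
    using exists_signs_two_over_pi[OF F(1)] by blast
  obtain f where f: "f \<in> complex_dual" "onorm f = 1" "\<forall>i\<in>F. f (x i) \<in> (if i \<in> P then ball z \<eta> else ball w \<eta>)"
    using patterns[of P] by blast
  obtain g where g: "g \<in> complex_dual" "onorm g = 1" "\<forall>i\<in>F. g (x i) \<in> (if i \<in> -P then ball z \<eta> else ball w \<eta>)"
    using patterns[of "-P"] by blast
  have le: "cmod (h v) \<le> \<epsilon>" if "h \<in> complex_dual" "onorm h = 1" for h
    using onorm[of h v] that F(3) by (auto simp: complex_dual_def v_def)
  define \<sigma> :: "'i \<Rightarrow> complex" where "\<sigma> i = (if i \<in> P then 1 else - 1)" for i
  define e where "e i = f (x i) - g (x i) - \<sigma> i * (z - w)" for i
  have e: "cmod (e i) \<le> 2 * \<eta>" if "i \<in> F" for i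
  proof (cases "i \<in> P")
    case True
    then have "cmod (z - f (x i)) < \<eta>" "cmod (w - g (x i)) < \<eta>"
      using f(3) g(3) that by (auto simp: dist_norm dest!: bspec)
    moreover have ei: "e i = (w - g (x i)) - (z - f (x i))" using True by (simp add: e_def \<sigma>_def)
    moreover have "cmod (e i) \<le> cmod (w - g (x i)) + cmod (z - f (x i))"
      unfolding ei by (rule norm_triangle_ineq4)
    ultimately show ?thesis by linarith
  next
    case False
    then have "cmod (w - f (x i)) < \<eta>" "cmod (z - g (x i)) < \<eta>"
      using f(3) g(3) that by (auto simp: dist_norm dest!: bspec)
    moreover have ei: "e i = (z - g (x i)) - (w - f (x i))" using False by (simp add: e_def \<sigma>_def)
    moreover have "cmod (e i) \<le> cmod (z - g (x i)) + cmod (w - f (x i))"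
      unfolding ei by (rule norm_triangle_ineq4)
    ultimately show ?thesis by linarith
  qed
  have "f v - g v = (\<Sum>i\<in>F. a i * (f (x i) - g (x i)))"
    unfolding v_def by (simp add: complex_dual_sum f(1) g(1) sum_subtractf algebra_simps)
  also have "\<dots> = (\<Sum>i\<in>F. a i * \<sigma> i) * (z - w) + (\<Sum>i\<in>F. a i * e i)"
    by (simp add: e_def sum_distrib_right flip: sum.distrib) (simp add: algebra_simps)
  finally have eq: "(\<Sum>i\<in>F. a i * \<sigma> i) * (z - w) = f v - g v - (\<Sum>i\<in>F. a i * e i)" by simp
  have "cmod (\<Sum>i\<in>F. a i * e i) \<le> (\<Sum>i\<in>F. cmod (a i) * (2 * \<eta>))"
    by (intro sum_norm_le) (auto simp: norm_mult intro: mult_left_mono e)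
  also have "\<dots> = 2 * \<eta>" using F(2) by (simp flip: sum_distrib_right)
  finally have err: "cmod (\<Sum>i\<in>F. a i * e i) \<le> 2 * \<eta>" .
  have "2 / pi \<le> cmod (\<Sum>i\<in>F. a i * \<sigma> i)"
    using P F(2) by (simp add: \<sigma>_def if_distrib cong: if_cong)
  then have "2 / pi * cmod (z - w) \<le> cmod ((\<Sum>i\<in>F. a i * \<sigma> i) * (z - w))"
    unfolding norm_mult by (intro mult_right_mono) auto
  also have "\<dots> \<le> cmod (f v) + cmod (g v) + cmod (\<Sum>i\<in>F. a i * e i)"
    unfolding eq using norm_triangle_ineq4[of "f v - g v" "\<Sum>i\<in>F. a i * e i"] norm_triangle_ineq4[of "f v" "g v"]
    by linarith
  also have "\<dots> \<le> 2 * (\<epsilon> + \<eta>)" using le[OF f(1,2)] le[OF g(1,2)] err by simp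
  finally show ?thesis by (simp add: field_simps)
qed

theorem theorem3p1:
  fixes x :: "nat \<Rightarrow> 'a::complex_banach" and \<epsilon> :: real
  assumes "\<epsilon> > 0"
    and "bounded (range x)"
    and "admits_l1_blocks \<epsilon> x"
  shows "\<exists>n :: nat \<Rightarrow> nat. strict_mono n \<and>
    (\<forall>f \<in> complex_dual. onorm f = 1 \<longrightarrow>
       diameter (cluster_points (\<lambda>k. f (x (n k)))) \<le> pi * \<epsilon>)"
proof (rule ccontr)
  assume contra: "\<not> ?thesis"
  obtain \<B> :: "complex set set" where \<B>: "countable \<B>" "topological_basis \<B>"
    using ex_countable_basis by blast
  define A :: "complex set \<Rightarrow> nat \<Rightarrow> ('a \<Rightarrow> complex) set"
    where "A U m = {f\<in>complex_dual. onorm f = 1 \<and> f (x m) \<in> U}" for U m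
  define far where "far U V \<longleftrightarrow>
    (\<exists>z w \<eta>. U \<subseteq> ball z \<eta> \<and> V \<subseteq> ball w \<eta> \<and> cmod (z - w) > pi * (\<epsilon> + \<eta>))" for U V
  \<comment> \<open>The alternatives are the pairs of basic open sets, numbered by \<open>k\<close>.\<close>
  define Q where "Q k M \<longleftrightarrow> (\<exists>U V. from_nat_into (\<B> \<times> \<B>) k = (U, V) \<and>
    far U V \<and> (\<exists>f. separates (A U) (A V) f M))" for k :: nat and M
  have ex: "\<exists>k. Q k M" if M: "infinite M" for M
  proof -
    let ?n = "enumerate M"
    obtain f where f: "f \<in> complex_dual" "onorm f = 1"
      and large: "\<not> diameter (cluster_points (\<lambda>k. f (x (?n k)))) \<le> pi * \<epsilon>"
      using contra strict_mono_enumerate[OF M] by blast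
    obtain z w where zw: "z \<in> cluster_points (\<lambda>k. f (x (?n k)))" "w \<in> cluster_points (\<lambda>k. f (x (?n k)))"
      and gap: "\<not> cmod (z - w) \<le> pi * \<epsilon>"
      using large diameter_le[of _ "pi * \<epsilon>"] \<open>\<epsilon> > 0\<close> by (metis less_imp_le mult_nonneg_nonneg pi_ge_zero)
    \<comment> \<open>With this radius \<open>\<pi>(\<epsilon> + \<eta>)\<close> is the midpoint of \<open>\<pi>\<epsilon>\<close> and \<open>\<bar>z - w\<bar>\<close>, hence still less than \<open>\<bar>z - w\<bar>\<close>.\<close>
    define \<eta> where "\<eta> = (cmod (z - w) - pi * \<epsilon>) / (2 * pi)"
    have "\<eta> > 0" using gap by (simp add: \<eta>_def)
    have "pi * (\<epsilon> + \<eta>) = (pi * \<epsilon> + cmod (z - w)) / 2" by (simp add: \<eta>_def field_simps)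
    then have gap': "cmod (z - w) > pi * (\<epsilon> + \<eta>)" using gap by simp
    obtain U where U: "U \<in> \<B>" "z \<in> U" "U \<subseteq> ball z \<eta>"
      using topological_basisE[OF \<B>(2), of "ball z \<eta>" z] \<open>\<eta> > 0\<close> by auto
    obtain V where V: "V \<in> \<B>" "w \<in> V" "V \<subseteq> ball w \<eta>"
      using topological_basisE[OF \<B>(2), of "ball w \<eta>" w] \<open>\<eta> > 0\<close> by auto
    have inf: "infinite {m\<in>M. f \<in> A W m}"
      if "y \<in> cluster_points (\<lambda>k. f (x (?n k)))" "W \<in> \<B>" "y \<in> W" for y W
    proof -
      have "open W" using \<B>(2) that(2) by (rule topological_basis_open)
      then have "\<exists>\<^sub>F k in sequentially. f (x (?n k)) \<in> W"
        using that by (simp add: cluster_points_def)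
      then have "infinite {k. f (x (?n k)) \<in> W}"
        by (simp add: frequently_cofinite flip: cofinite_eq_sequentially)
      then have "infinite (?n ` {k. f (x (?n k)) \<in> W})"
        using strict_mono_enumerate[OF M] by (simp add: finite_image_iff strict_mono_imp_inj_on inj_on_subset)
      moreover have "?n ` {k. f (x (?n k)) \<in> W} \<subseteq> {m\<in>M. f \<in> A W m}"
        using f enumerate_in_set[OF M] by (auto simp: A_def)
      ultimately show ?thesis using finite_subset by blast
    qed
    have "separates (A U) (A V) f M"
      using inf zw U V by (auto simp: separates_def)
    moreover have "far U V" using U V gap' by (auto simp: far_def)
    moreover obtain k where "from_nat_into (\<B> \<times> \<B>) k = (U, V)"
      using from_nat_into_surj[of "\<B> \<times> \<B>" "(U, V)"] \<B>(1) U V by auto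
    ultimately show ?thesis by (auto simp: Q_def)
  qed
  have "\<exists>k. \<exists>N'\<subseteq>UNIV. infinite N' \<and> (\<forall>M\<subseteq>N'. infinite M \<longrightarrow> Q k M)"
  proof (rule countable_alternatives_stabilise[of UNIV Q])
    show "Q k M'" if "Q k M" "finite (M - M')" for k M M'
    proof -
      from that(1) obtain U V f where "from_nat_into (\<B> \<times> \<B>) k = (U, V)" "far U V"
          "separates (A U) (A V) f M"
        unfolding Q_def by blast
      moreover from this(3) that(2) have "separates (A U) (A V) f M'"
        by (rule separates_almost_mono)
      ultimately show ?thesis unfolding Q_def by blast
    qed
  qed (use ex in auto)
  then obtain k N where N: "infinite N" "\<And>M. M \<subseteq> N \<Longrightarrow> infinite M \<Longrightarrow> Q k M" by blast
  obtain U V where UV: "from_nat_into (\<B> \<times> \<B>) k = (U, V)" by fastforce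
  have QUV: "far U V \<and> (\<exists>f. separates (A U) (A V) f M)" if "M \<subseteq> N" "infinite M" for M
    using N(2)[OF that] UV by (simp add: Q_def)
  then have "far U V" using N(1) by blast
  have sep: "\<exists>f. separates (A U) (A V) f M" if "M \<subseteq> N" "infinite M" for M
    using QUV[OF that] by blast
  from \<open>far U V\<close> obtain z w \<eta> where disc: "U \<subseteq> ball z \<eta>" "V \<subseteq> ball w \<eta>" "cmod (z - w) > pi * (\<epsilon> + \<eta>)"
    by (auto simp: far_def)
  have "\<exists>K\<subseteq>N. infinite K \<and> (\<forall>F\<subseteq>K. finite F \<longrightarrow> (\<forall>P. \<exists>f. follows (A U) (A V) f P F))"
    by (rule independent_subset[OF N(1)]) (rule sep)
  then obtain K where "infinite K"
    and K: "\<forall>F\<subseteq>K. finite F \<longrightarrow> (\<forall>P. \<exists>f. follows (A U) (A V) f P F)"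
    by (elim exE conjE)
  obtain F a where F: "finite F" "F \<subseteq> K" "(\<Sum>i\<in>F. cmod (a i)) = 1" "norm (\<Sum>i\<in>F. a i *\<^sub>C x i) \<le> \<epsilon>"
    by (rule admits_l1_blocksE[OF assms(3) \<open>infinite K\<close>])
  \<comment> \<open>On the empty set a pattern says nothing, not even that the point following it is a
    functional of norm one.\<close>
  then have "F \<noteq> {}" by auto
  have "cmod (z - w) \<le> pi * (\<epsilon> + \<eta>)"
  proof (rule block_forces_close_discs[OF F(1,3,4)])
    fix P
    obtain f where f: "follows (A U) (A V) f P F" using K[rule_format, OF F(2,1), of P] by (elim exE)
    then have "f \<in> complex_dual" "onorm f = 1"
      using \<open>F \<noteq> {}\<close> by (auto simp: follows_def A_def split: if_splits)
    moreover have "\<forall>i\<in>F. f (x i) \<in> (if i \<in> P then ball z \<eta> else ball w \<eta>)"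
      using f disc by (force simp: follows_def A_def split: if_splits)
    ultimately show "\<exists>f\<in>complex_dual. onorm f = 1 \<and>
        (\<forall>i\<in>F. f (x i) \<in> (if i \<in> P then ball z \<eta> else ball w \<eta>))" by blast
  qed
  then show False using disc(3) by simp
qed

end
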